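(* Let $\alpha\in(0,1)$ and let $\rho_{AB}=|\psi\rangle\langle\psi|_{AB}$ be a pure state on $\mathbb{C}_A\otimes\mathbb{C}_B$. Then $$C_\alpha(\rho_{AB})=S_\alpha(\rho_A),\qquad \rho_A=\mathrm{Tr}_B(|\psi\rangle\langle\psi|_{AB}).$$
   Context: All Hilbert spaces are finite-dimensional complex Hilbert spaces. A state is a positive semidefinite operator of trace one. Quantum $\alpha$-Rényi entropy: $S_\alpha(\rho)=\frac{1}{1-\alpha}\log\mathrm{Tr}(\rho^\alpha)$. $\alpha$-quantum Jensen-Shannon divergence of an ensemble $\xi=\{p_k,\rho_k\}_k$ of states: $Q_\alpha(\xi)=S_\alpha\big(\sum_k p_k\rho_k\big)-\sum_k p_kS_\alpha(\rho_k)$. For a POVM $M_B=\{M_x\}_x$ on $B$ (finitely many positive semidefinite operators summing to the identity), let $\xi_{AB}^{M_B}=\{p_x,\rho_x^A\}_x$, where $p_x\rho_x^A=\mathrm{Tr}_B\big((\mathbb{I}_A\otimes M_x)\rho_{AB}\big)$ and $p_x$ is the trace of this operator (terms with $p_x=0$ are dropped). Define $C_\alpha(\rho_{AB})=\sup_{M_B}Q_\alpha(\xi_{AB}^{M_B})$, the supremum being over all POVMs on $B$. *)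

theory Defs
  imports "HOL-Analysis.Analysis"
begin

text \<open>A finite-dimensional Hilbert space is represented in coordinates as \<open>complex^'n\<close>, operators on
  it as matrices \<open>complex^'n^'n\<close>, and the tensor product of \<open>complex^'a\<close> and \<open>complex^'b\<close> as
  \<open>complex^('a \<times> 'b)\<close>. The norm \<open>norm\<close> of \<open>complex^'n\<close> is the Hilbert space norm.\<close>

definition cinner :: "complex^'n \<Rightarrow> complex^'n \<Rightarrow> complex" where
  "cinner u v = (\<Sum>i\<in>UNIV. cnj (u $ i) * v $ i)"

definition cadjoint :: "complex^'n^'m \<Rightarrow> complex^'m^'n" where
  "cadjoint A = (\<chi> i j. cnj (A $ j $ i))"

definition unitary :: "complex^'n^'n \<Rightarrow> bool" where
  "unitary U \<longleftrightarrow> cadjoint U ** U = mat 1 \<and> U ** cadjoint U = mat 1"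

definition psd :: "complex^'n^'n \<Rightarrow> bool" where
  "psd A \<longleftrightarrow> cadjoint A = A \<and> (\<forall>v. 0 \<le> Re (cinner v (A *v v)))"

definition ketbra :: "complex^'n \<Rightarrow> complex^'n^'n" where
  "ketbra \<psi> = (\<chi> i j. \<psi> $ i * cnj (\<psi> $ j))"

definition tensor ::
    "complex^'a^'a \<Rightarrow> complex^'b^'b \<Rightarrow> complex^('a::finite \<times> 'b::finite)^('a \<times> 'b)" where
  "tensor A B = (\<chi> i j. A $ fst i $ fst j * B $ snd i $ snd j)"

definition ptrace_B ::
    "complex^('a::finite \<times> 'b::finite)^('a \<times> 'b) \<Rightarrow> complex^'a^'a" where
  "ptrace_B X = (\<chi> i j. \<Sum>k\<in>UNIV. X $ (i, k) $ (j, k))"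

definition diag_real :: "real^'n \<Rightarrow> complex^'n^'n" where
  "diag_real d = (\<chi> i j. if i = j then complex_of_real (d $ i) else 0)"

text \<open>Real powers of positive semidefinite matrices by the functional calculus. The result does not
  depend on the diagonalization chosen. Since \<open>0 powr s = 0\<close>, kernels are mapped to \<open>0\<close>.\<close>

definition psd_powr :: "complex^'n^'n \<Rightarrow> real \<Rightarrow> complex^'n^'n" where
  "psd_powr A s = (THE B. \<exists>U d. unitary U \<and> (\<forall>i. 0 \<le> d $ i)
      \<and> A = U ** diag_real d ** cadjoint U
      \<and> B = U ** diag_real (\<chi> i. d $ i powr s) ** cadjoint U)"

text \<open>The logarithm is natural; another base rescales all entropic quantities below by the same
  positive constant.\<close>

definition renyi_entropy :: "real \<Rightarrow> complex^'n^'n \<Rightarrow> real" where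
  "renyi_entropy \<alpha> \<rho> = 1 / (1 - \<alpha>) * ln (Re (trace (psd_powr \<rho> \<alpha>)))"

text \<open>A finite ensemble is a list of pairs of a probability and a state.\<close>

definition qjsd :: "real \<Rightarrow> (real \<times> (complex^'n^'n)) list \<Rightarrow> real" where
  "qjsd \<alpha> \<xi> = renyi_entropy \<alpha> (\<Sum>(p, \<rho>)\<leftarrow>\<xi>. p *\<^sub>R \<rho>) - (\<Sum>(p, \<rho>)\<leftarrow>\<xi>. p * renyi_entropy \<alpha> \<rho>)"

definition povm :: "(complex^'n^'n) list \<Rightarrow> bool" where
  "povm M \<longleftrightarrow> (\<forall>E\<in>set M. psd E) \<and> sum_list M = mat 1"

definition cond_op ::
    "complex^('a::finite \<times> 'b::finite)^('a \<times> 'b) \<Rightarrow> complex^'b^'b \<Rightarrow> complex^'a^'a" where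
  "cond_op \<rho> E = ptrace_B (tensor (mat 1) E ** \<rho>)"

definition outcome_prob ::
    "complex^('a::finite \<times> 'b::finite)^('a \<times> 'b) \<Rightarrow> complex^'b^'b \<Rightarrow> real" where
  "outcome_prob \<rho> E = Re (trace (cond_op \<rho> E))"

definition post_ensemble ::
    "complex^('a::finite \<times> 'b::finite)^('a \<times> 'b) \<Rightarrow> (complex^'b^'b) list \<Rightarrow> (real \<times> (complex^'a^'a)) list" where
  "post_ensemble \<rho> M =
     map (\<lambda>E. (outcome_prob \<rho> E, (1 / outcome_prob \<rho> E) *\<^sub>R cond_op \<rho> E))
       (filter (\<lambda>E. outcome_prob \<rho> E \<noteq> 0) M)"

text \<open>The supremum is taken in \<open>ereal\<close>, where it exists without a boundedness proof.\<close>

definition C_div :: "real \<Rightarrow> complex^('a::finite \<times> 'b::finite)^('a \<times> 'b) \<Rightarrow> ereal" where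
  "C_div \<alpha> \<rho> = (SUP M\<in>{M. povm M}. ereal (qjsd \<alpha> (post_ensemble \<rho> M)))"

end

theory Submission imports Defs
begin

text \<open>For every POVM the average of the post-measurement ensemble is \<open>\<rho>A\<close>, so only the average entropy
  of the members depends on the measurement. It is nonnegative, and it vanishes for a rank-one POVM,
  because such a measurement on \<open>B\<close> leaves \<open>A\<close> in a pure state when the joint state is pure.\<close>

section \<open>Adjoints and the complex inner product\<close>

text \<open>The real inner product, with its norm and topology, can thus stand in for the real part
  of the complex one.\<close>

lemma Re_cinner: "Re (cinner u v) = inner u v"
  by (simp add: cinner_def inner_vec_def inner_complex_def)

lemma cinner_commute: "cinner v u = cnj (cinner u v)"
  by (simp add: cinner_def mult.commute)

lemma cinner_self: "cinner v v = complex_of_real (inner v v)"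
  by (simp add: complex_eq_iff Re_cinner) (simp add: cinner_def)

lemma cinner_diff_right: "cinner u (v - w) = cinner u v - cinner u w"
  by (simp add: cinner_def right_diff_distrib sum_subtractf)

lemma cinner_scaleR_right: "cinner u (c *\<^sub>R v) = c *\<^sub>R cinner u v"
  by (simp add: cinner_def scaleR_sum_right)

lemma cinner_scaleR_left: "cinner (c *\<^sub>R u) v = c *\<^sub>R cinner u v"
  by (simp add: cinner_def scaleR_sum_right)

lemma cinner_matrix_right: "cinner u (A *v v) = cinner (cadjoint A *v u) v"
proof -
  have "cinner u (A *v v) = (\<Sum>i\<in>UNIV. \<Sum>j\<in>UNIV. cnj (u $ i) * (A $ i $ j * v $ j))"
    by (simp add: cinner_def matrix_vector_mult_def sum_distrib_left)
  also have "\<dots> = (\<Sum>j\<in>UNIV. \<Sum>i\<in>UNIV. cnj (u $ i) * (A $ i $ j * v $ j))"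
    by (rule sum.swap)
  also have "\<dots> = cinner (cadjoint A *v u) v"
    by (simp add: cinner_def matrix_vector_mult_def cadjoint_def sum_distrib_right sum_distrib_left mult_ac)
  finally show ?thesis .
qed

lemma matrix_vector_scaleR: "(A :: complex^'n^'m) *v (c *\<^sub>R v) = c *\<^sub>R (A *v v)"
  by (simp add: vec_eq_iff matrix_vector_mult_def scaleR_sum_right)

lemma scaleR_matrix_vector: "(c *\<^sub>R (A :: complex^'n^'m)) *v v = c *\<^sub>R (A *v v)"
  by (simp add: vec_eq_iff matrix_vector_mult_def scaleR_sum_right)

lemma cadjoint_scaleR: "cadjoint (c *\<^sub>R A) = c *\<^sub>R cadjoint A"
  by (simp add: vec_eq_iff cadjoint_def)

lemma psd_scaleR: "psd A \<Longrightarrow> 0 \<le> c \<Longrightarrow> psd (c *\<^sub>R A)"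
  by (simp add: psd_def cadjoint_scaleR scaleR_matrix_vector cinner_scaleR_right)

section \<open>The spectral theorem for Hermitian matrices\<close>

text \<open>A maximizer of the quadratic form of \<open>A\<close> on the unit sphere of the
  orthogonal complement is an eigenvector, by first-order variation. The vector \<open>v0\<close>
  makes that sphere nonempty.\<close>

lemma hermitian_eigenvector_in_orthogonal_complement:
  fixes A :: "complex^'n^'n" and u :: "'i \<Rightarrow> complex^'n"
  assumes herm: "cadjoint A = A"
    and eig: "\<And>i. i \<in> I \<Longrightarrow> A *v u i = d i *\<^sub>R u i"
    and v0: "v0 \<noteq> 0" "\<And>i. i \<in> I \<Longrightarrow> cinner (u i) v0 = 0"
  obtains w c where "cinner w w = 1" "\<And>i. i \<in> I \<Longrightarrow> cinner (u i) w = 0" "A *v w = c *\<^sub>R w"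
proof -
  define V where "V = {v. \<forall>i\<in>I. cinner (u i) v = 0}"
  define q where "q v = inner v (A *v v)" for v
  have q_scale: "q (c *\<^sub>R v) = c\<^sup>2 * q v" for c v
    by (simp add: q_def matrix_vector_scaleR power2_eq_square)
  have V_scale: "c *\<^sub>R v \<in> V" if "v \<in> V" for c v
    using that by (simp add: V_def cinner_scaleR_right)
  have V_diff: "v - w \<in> V" if "v \<in> V" "w \<in> V" for v w
    using that by (simp add: V_def cinner_diff_right)
  \<comment> \<open>Moving \<open>A\<close> to the left argument turns \<open>u i\<close> into a
    real multiple of itself, so orthogonality to \<open>u i\<close> persists.\<close>
  have V_A: "A *v v \<in> V" if "v \<in> V" for v
    using that by (simp add: V_def cinner_matrix_right herm eig cinner_scaleR_left)
  have "V = (\<Inter>i\<in>I. {v. cinner (u i) v = 0})"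
    by (auto simp: V_def)
  moreover have "closed {v. cinner (u i) v = 0}" for i
    unfolding cinner_def by (intro closed_Collect_eq continuous_intros)
  ultimately have "closed V"
    by auto
  then have "compact (sphere 0 1 \<inter> V)"
    by (intro compact_Int_closed compact_sphere)
  moreover have "(1 / norm v0) *\<^sub>R v0 \<in> sphere 0 1 \<inter> V"
    using v0 by (simp add: V_def cinner_scaleR_right)
  moreover have "continuous_on (sphere 0 1 \<inter> V) q"
    unfolding q_def matrix_vector_mult_def by (intro continuous_intros)
  ultimately obtain w where w: "w \<in> sphere 0 1 \<inter> V"
    and max: "\<And>y. y \<in> sphere 0 1 \<inter> V \<Longrightarrow> q y \<le> q w"
    by (metis continuous_attains_sup empty_iff)
  \<comment> \<open>Maximality of \<open>q w\<close> makes \<open>B\<close> nonnegative on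
    \<open>V\<close>, while \<open>inner w (B w) = 0\<close>. A symmetric nonnegative form vanishing
    at \<open>w\<close> forces \<open>B w = 0\<close>, which is the eigenvalue equation.\<close>
  define B where "B v = q w *\<^sub>R v - A *v v" for v
  have ww: "inner w w = 1"
    using w by (simp add: norm_eq_1)
  have A_sym: "inner (A *v x) y = inner x (A *v y)" for x y
    by (metis Re_cinner cinner_matrix_right herm)
  have B_sym: "inner x (B y) = inner (B x) y" for x y
    by (simp add: B_def inner_diff_left inner_diff_right A_sym)
  have B_nonneg: "0 \<le> inner v (B v)" if "v \<in> V" for v
  proof (cases "v = 0")
    case False
    then have "q ((1 / norm v) *\<^sub>R v) \<le> q w"
      using that by (intro max) (simp add: V_scale)
    then have "q v \<le> q w * (norm v)\<^sup>2"
      using False by (simp add: q_scale field_simps)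
    then show ?thesis
      by (simp add: B_def q_def inner_diff_right power2_norm_eq_inner)
  qed simp
  define x where "x = B w"
  have xV: "x \<in> V"
    using w by (simp add: x_def B_def V_diff V_scale V_A)
  have wx: "inner w x = 0"
    by (simp add: x_def B_def inner_diff_right ww q_def)
  \<comment> \<open>The constant term vanishes since \<open>inner w x = 0\<close>, and symmetry of
    \<open>B\<close> turns both cross terms into \<open>inner x x\<close>. Unless
    \<open>x = 0\<close>, the linear term makes the form negative for small
    \<open>t > 0\<close>.\<close>
  have B_expand: "inner (w - t *\<^sub>R x) (B (w - t *\<^sub>R x))
      = - 2 * t * inner x x + t\<^sup>2 * inner x (B x)" for t
  proof -
    have "B (w - t *\<^sub>R x) = x - t *\<^sub>R B x"
      by (simp add: x_def B_def matrix_vector_mult_diff_distrib matrix_vector_scaleR algebra_simps)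
    moreover have "inner w (B x) = inner x x"
      using B_sym[of w x] by (simp add: x_def)
    ultimately show ?thesis
      using wx by (simp add: inner_diff_left inner_diff_right power2_eq_square right_diff_distrib)
  qed
  have ineq: "2 * t * inner x x \<le> t\<^sup>2 * inner x (B x)" for t
    using B_nonneg[of "w - t *\<^sub>R x"] B_expand[of t] w xV by (simp add: V_diff V_scale)
  have "inner x x = 0"
  proof (rule ccontr)
    assume "inner x x \<noteq> 0"
    then have pos: "0 < inner x x"
      by (simp add: order_less_le)
    define b where "b = inner x (B x)"
    \<comment> \<open>The quadratic is smallest at \<open>inner x x / b\<close>; the summand 1
      guards against \<open>b = 0\<close>.\<close>
    define t where "t = inner x x / (1 + b)"
    have b: "0 \<le> b"
      using B_nonneg[OF xV] by (simp add: b_def)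
    then have t: "0 < t"
      using pos by (simp add: t_def)
    have "2 * inner x x \<le> t * b"
      using ineq[of t] t by (simp add: b_def power2_eq_square)
    also have "t * b \<le> t * (1 + b)"
      using t by (simp add: algebra_simps)
    also have "\<dots> = inner x x"
      using b by (simp add: t_def)
    finally show False
      using pos by simp
  qed
  then have "A *v w = q w *\<^sub>R w"
    by (simp add: x_def B_def)
  with w ww show thesis
    by (intro that[of w "q w"]) (auto simp: V_def cinner_self)
qed

text \<open>Induction over \<open>I\<close> adds one eigenvector at a time. Indexing by
  \<open>'n\<close> itself keeps the number of earlier vectors below the dimension, so some
  direction orthogonal to all of them is left.\<close>

lemma hermitian_orthonormal_eigenvectors:
  fixes A :: "complex^'n^'n"
  assumes herm: "cadjoint A = A"
  shows "\<exists>(u :: 'n \<Rightarrow> complex^'n) d. \<forall>i\<in>I. A *v u i = d i *\<^sub>R u i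
    \<and> (\<forall>j\<in>I. cinner (u i) (u j) = (if i = j then 1 else 0))"
  using finite[of I]
proof (induction I rule: finite_induct)
  case empty
  then show ?case by simp
next
  case (insert k I)
  then obtain u :: "'n \<Rightarrow> complex^'n" and d
    where eig: "\<And>i. i \<in> I \<Longrightarrow> A *v u i = d i *\<^sub>R u i"
      and orth: "\<And>i j. i \<in> I \<Longrightarrow> j \<in> I \<Longrightarrow> cinner (u i) (u j) = (if i = j then 1 else 0)"
    by metis
  txt \<open>Row \<open>k\<close> of \<open>M\<close> vanishes, so \<open>M\<close> has a nontrivial kernel.\<close>
  define M :: "complex^'n^'n" where "M = (\<chi> i j. if i \<in> I then cnj (u i $ j) else 0)"
  have "row k M = 0"
    using insert by (simp add: M_def row_def vec_eq_iff)
  then have "det M = 0"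
    by (simp add: det_zero_row)
  then have "\<not> invertible M"
    by (simp add: invertible_det_nz)
  then obtain v0 where v0: "v0 \<noteq> 0" "M *v v0 = 0"
    by (metis invertible_left_inverse matrix_left_invertible_ker)
  have "cinner (u i) v0 = 0" if "i \<in> I" for i
    using v0(2) that by (auto simp: vec_eq_iff M_def matrix_vector_mult_def cinner_def dest: spec[of _ i])
  with herm eig v0 obtain w c where w: "cinner w w = 1" "\<And>i. i \<in> I \<Longrightarrow> cinner (u i) w = 0"
    "A *v w = c *\<^sub>R w"
    by (metis hermitian_eigenvector_in_orthogonal_complement)
  have w': "cinner w (u i) = 0" if "i \<in> I" for i
    using w(2)[OF that] cinner_commute[of w "u i"] by simp
  show ?case
    using insert.hyps eig orth w w'
    by (intro exI[of _ "u(k := w)"] exI[of _ "d(k := c)"]) auto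
qed

section \<open>Diagonalization and powers of positive semidefinite matrices\<close>

lemma diag_real_nth: "diag_real d $ i $ j = (if i = j then complex_of_real (d $ i) else 0)"
  by (simp add: diag_real_def)

lemma matrix_mul_diag_real_right: "(A ** diag_real d) $ i $ j = A $ i $ j * complex_of_real (d $ j)"
  by (simp add: matrix_matrix_mult_def diag_real_nth if_distrib[of "\<lambda>x. _ * x"] sum.delta cong: if_cong)

lemma matrix_mul_diag_real_left: "(diag_real d ** A) $ i $ j = complex_of_real (d $ i) * A $ i $ j"
  by (simp add: matrix_matrix_mult_def diag_real_nth if_distrib[of "\<lambda>x. x * _"] sum.delta cong: if_cong)

text \<open>The columns of \<open>U\<close> are orthonormal eigenvectors, and the eigenvalue
  \<open>d i\<close> is the real part of \<open>cinner (u i) (A *v u i)\<close>, hence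
  nonnegative.\<close>

theorem psd_spectral:
  fixes A :: "complex^'a^'a"
  assumes "psd A"
  obtains U d where "unitary U" "\<And>i. 0 \<le> d $ i" "A = U ** diag_real d ** cadjoint U"
proof -
  from assms have herm: "cadjoint A = A" and pos: "\<And>v. 0 \<le> Re (cinner v (A *v v))"
    by (auto simp: psd_def)
  from hermitian_orthonormal_eigenvectors[OF herm, of UNIV]
  obtain u :: "'a \<Rightarrow> complex^'a" and d
    where eig: "\<And>i. A *v u i = d i *\<^sub>R u i"
      and orth: "\<And>i j. cinner (u i) (u j) = (if i = j then 1 else 0)"
    by (metis UNIV_I)
  define U where "U = (\<chi> i j. u j $ i)"
  have U: "cadjoint U ** U = mat 1"
    using orth by (simp add: vec_eq_iff U_def cadjoint_def matrix_matrix_mult_def mat_def cinner_def)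
  then have U': "U ** cadjoint U = mat 1"
    by (simp add: matrix_left_right_inverse)
  have d: "0 \<le> d i" for i
    using pos[of "u i"] orth[of i i] by (simp add: eig cinner_scaleR_right)
  have "A ** U = U ** diag_real (\<chi> i. d i)"
  proof -
    have "(A ** U) $ i $ j = (A *v u j) $ i" for i j
      by (simp add: matrix_matrix_mult_def matrix_vector_mult_def U_def)
    then show ?thesis
      by (simp add: vec_eq_iff matrix_mul_diag_real_right eig U_def complex_eq_iff)
  qed
  then have "A = U ** diag_real (\<chi> i. d i) ** cadjoint U"
    by (metis U' matrix_mul_assoc matrix_mul_rid)
  then show thesis
    using U U' d by (intro that[of U "\<chi> i. d i"]) (auto simp: unitary_def)
qed

text \<open>With \<open>W = V\<^sup>* U\<close> the two diagonalizations say \<open>W $ i $ j * d $ j = e $ i * W $ i $ j\<close>: the entry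
  \<open>W $ i $ j\<close> vanishes unless \<open>d $ j = e $ i\<close>, and so \<open>W\<close> also intertwines the diagonals \<open>f d\<close>, \<open>f e\<close>.\<close>
lemma functional_calculus_unique:
  assumes U: "unitary U" and V: "unitary V"
    and eq: "U ** diag_real d ** cadjoint U = V ** diag_real e ** cadjoint V"
  shows "U ** diag_real (\<chi> i. f (d $ i)) ** cadjoint U = V ** diag_real (\<chi> i. f (e $ i)) ** cadjoint V"
proof -
  define W where "W = cadjoint V ** U"
  have UU: "cadjoint U ** U = mat 1" "U ** cadjoint U = mat 1"
    and VV: "cadjoint V ** V = mat 1" "V ** cadjoint V = mat 1"
    using U V by (auto simp: unitary_def)
  have "W ** diag_real d = cadjoint V ** (U ** diag_real d ** cadjoint U) ** U"
    by (metis UU(1) W_def matrix_mul_assoc matrix_mul_rid)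
  also have "\<dots> = diag_real e ** W"
    unfolding eq by (metis VV(1) W_def matrix_mul_assoc matrix_mul_lid)
  finally have "W $ i $ j * complex_of_real (d $ j) = complex_of_real (e $ i) * W $ i $ j" for i j
    by (metis matrix_mul_diag_real_left matrix_mul_diag_real_right)
  then have "W $ i $ j = 0 \<or> d $ j = e $ i" for i j
    by (metis mult.commute mult_cancel_left of_real_eq_iff)
  then have "W $ i $ j * complex_of_real (f (d $ j)) = complex_of_real (f (e $ i)) * W $ i $ j" for i j
    by (metis mult.commute mult_zero_left)
  then have W: "W ** diag_real (\<chi> i. f (d $ i)) = diag_real (\<chi> i. f (e $ i)) ** W"
    by (simp add: vec_eq_iff matrix_mul_diag_real_left matrix_mul_diag_real_right)
  \<comment> \<open>Here \<open>V ** W = U\<close>, and after the intertwining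
    \<open>W ** cadjoint U = cadjoint V\<close>.\<close>
  have "U ** diag_real (\<chi> i. f (d $ i)) ** cadjoint U
      = V ** (W ** diag_real (\<chi> i. f (d $ i))) ** cadjoint U"
    by (metis VV(2) W_def matrix_mul_assoc matrix_mul_lid)
  also have "\<dots> = V ** diag_real (\<chi> i. f (e $ i)) ** cadjoint V"
    unfolding W by (metis UU(2) W_def matrix_mul_assoc matrix_mul_rid)
  finally show ?thesis .
qed

text \<open>Uniqueness for the definite description is \<open>functional_calculus_unique\<close>
  applied to \<open>x powr s\<close>. From here on, any diagonalization computes the power.\<close>

lemma psd_powr_eq:
  assumes "unitary U" "\<And>i. 0 \<le> d $ i" "A = U ** diag_real d ** cadjoint U"
  shows "psd_powr A s = U ** diag_real (\<chi> i. d $ i powr s) ** cadjoint U"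
  unfolding psd_powr_def
proof (rule the_equality)
  show "\<exists>U' d'. unitary U' \<and> (\<forall>i. 0 \<le> d' $ i) \<and> A = U' ** diag_real d' ** cadjoint U'
      \<and> U ** diag_real (\<chi> i. d $ i powr s) ** cadjoint U
        = U' ** diag_real (\<chi> i. d' $ i powr s) ** cadjoint U'"
    using assms by blast
next
  fix B
  assume "\<exists>U d. unitary U \<and> (\<forall>i. 0 \<le> d $ i) \<and> A = U ** diag_real d ** cadjoint U
      \<and> B = U ** diag_real (\<chi> i. d $ i powr s) ** cadjoint U"
  then show "B = U ** diag_real (\<chi> i. d $ i powr s) ** cadjoint U"
    using assms functional_calculus_unique[where f = "\<lambda>x. x powr s"] by metis
qed

lemma trace_unitary_conjugate:
  assumes "unitary U"
  shows "Re (trace (U ** diag_real d ** cadjoint U)) = (\<Sum>i\<in>UNIV. d $ i)"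
proof -
  have "trace (U ** diag_real d ** cadjoint U) = trace (cadjoint U ** (U ** diag_real d))"
    by (rule trace_mul_sym)
  also have "\<dots> = trace (diag_real d)"
    using assms by (simp add: matrix_mul_assoc unitary_def)
  finally show ?thesis
    by (simp add: trace_def diag_real_nth)
qed

section \<open>Entropies of states\<close>

lemma psd_trace_nonneg: "psd A \<Longrightarrow> 0 \<le> Re (trace A)"
  by (metis psd_spectral trace_unitary_conjugate sum_nonneg)

text \<open>The trace is the sum of the nonnegative eigenvalues, so all of them vanish. This handles
  the outcomes of probability zero, which the ensemble drops.\<close>

lemma psd_trace_0D:
  assumes "psd A" "Re (trace A) = 0"
  shows "A = 0"
proof -
  from assms(1) obtain U d where U: "unitary U" "\<And>i. 0 \<le> d $ i" "A = U ** diag_real d ** cadjoint U"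
    using psd_spectral by blast
  then have "(\<Sum>i\<in>UNIV. d $ i) = 0"
    using assms(2) by (simp add: trace_unitary_conjugate)
  then have "diag_real d = 0"
    using U(2) by (simp add: sum_nonneg_eq_0_iff diag_real_nth vec_eq_iff)
  then show ?thesis
    by (simp add: U(3) vec_eq_iff matrix_matrix_mult_def)
qed

text \<open>The eigenvalues lie in [0,1], where \<open>x \<le> x powr \<alpha>\<close>, so the trace
  of the power is at least 1.\<close>

lemma renyi_entropy_nonneg:
  assumes "0 < \<alpha>" "\<alpha> < 1" "psd \<rho>" "Re (trace \<rho>) = 1"
  shows "0 \<le> renyi_entropy \<alpha> \<rho>"
proof -
  from assms obtain U d where U: "unitary U" "\<And>i. 0 \<le> d $ i" "\<rho> = U ** diag_real d ** cadjoint U"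
    using psd_spectral by blast
  then have tr: "(\<Sum>i\<in>UNIV. d $ i) = 1"
    using assms(4) by (simp add: trace_unitary_conjugate)
  have le1: "d $ i \<le> 1" for i
    using member_le_sum[of i UNIV "($) d"] U(2) tr by simp
  have "d $ i \<le> d $ i powr \<alpha>" for i
    using powr_mono'[of \<alpha> 1 "d $ i"] assms(2) U(2)[of i] le1[of i] by simp
  then have "1 \<le> (\<Sum>i\<in>UNIV. d $ i powr \<alpha>)"
    using sum_mono[of UNIV "($) d" "\<lambda>i. d $ i powr \<alpha>"] tr by simp
  then show ?thesis
    using assms(2)
    by (simp add: renyi_entropy_def psd_powr_eq[OF U] trace_unitary_conjugate[OF U(1)])
qed

text \<open>Idempotence forces the eigenvalues to be 0 or 1. Powers fix both, so the trace of the
  power is again 1 and its logarithm is 0.\<close>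

lemma renyi_entropy_pure:
  assumes "psd \<rho>" "\<rho> ** \<rho> = \<rho>" "Re (trace \<rho>) = 1"
  shows "renyi_entropy \<alpha> \<rho> = 0"
proof -
  from assms obtain U d where U: "unitary U" "\<And>i. 0 \<le> d $ i" "\<rho> = U ** diag_real d ** cadjoint U"
    using psd_spectral by blast
  have UU: "cadjoint U ** U = mat 1"
    using U(1) by (simp add: unitary_def)
  have D: "diag_real d = cadjoint U ** \<rho> ** U"
    unfolding U(3) by (metis UU matrix_mul_assoc matrix_mul_lid matrix_mul_rid)
  have "diag_real d ** diag_real d = cadjoint U ** (\<rho> ** \<rho>) ** U"
    unfolding U(3) by (metis UU matrix_mul_assoc matrix_mul_lid matrix_mul_rid)
  also have "\<dots> = diag_real d"
    by (simp add: assms(2) D)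
  finally have "(diag_real d ** diag_real d) $ i $ i = diag_real d $ i $ i" for i
    by simp
  then have "d $ i * d $ i = d $ i" for i
    by (metis diag_real_nth matrix_mul_diag_real_right of_real_eq_iff of_real_mult)
  then have "d $ i = 0 \<or> d $ i = 1" for i
    by (metis mult_cancel_left1)
  \<comment> \<open>Zero eigenvalues are covered by the convention that
    \<open>0 powr \<alpha> = 0\<close> for every exponent.\<close>
  then have "d $ i powr \<alpha> = d $ i" for i
    by (metis powr_0 powr_one_eq_one)
  moreover have "(\<Sum>i\<in>UNIV. d $ i) = 1"
    using assms(3) U(1,3) by (simp add: trace_unitary_conjugate)
  ultimately show ?thesis
    using U(1) by (simp add: renyi_entropy_def psd_powr_eq[OF U] trace_unitary_conjugate)
qed

section \<open>Rank-one operators\<close>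

lemma trace_ketbra: "trace (ketbra a) = cinner a a"
  by (simp add: trace_def ketbra_def cinner_def mult.commute)

lemma ketbra_mult_ketbra: "ketbra a ** ketbra a = (inner a a) *\<^sub>R ketbra a"
proof -
  have "(ketbra a ** ketbra a) $ i $ j = a $ i * cnj (a $ j) * cinner a a" for i j
    by (simp add: matrix_matrix_mult_def ketbra_def cinner_def sum_distrib_left mult_ac)
  then show ?thesis
    by (simp add: vec_eq_iff ketbra_def cinner_self complex_eq_iff algebra_simps)
qed

text \<open>The quadratic form at \<open>v\<close> is the squared modulus of
  \<open>cinner v a\<close>.\<close>

lemma psd_ketbra: "psd (ketbra a)"
proof -
  have "ketbra a *v v = (\<chi> i. a $ i * cinner a v)" for v
    by (simp add: vec_eq_iff matrix_vector_mult_def ketbra_def cinner_def sum_distrib_left mult_ac)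
  then have "cinner v (ketbra a *v v) = cinner v a * cinner a v" for v
    by (simp add: cinner_def[of v] sum_distrib_left mult_ac)
  then have "cinner v (ketbra a *v v) = cinner v a * cnj (cinner v a)" for v
    by (metis cinner_commute)
  then show ?thesis
    by (simp add: psd_def cadjoint_def ketbra_def vec_eq_iff mult.commute complex_mult_cnj)
qed

section \<open>Conditional states of a pure bipartite state\<close>

text \<open>The identity on \<open>A\<close> collapses the sum over the intermediate first index.
  The entrywise form makes linearity in \<open>E\<close> visible.\<close>

lemma cond_op_nth:
  "cond_op \<rho> E $ i $ j = (\<Sum>k\<in>UNIV. \<Sum>l\<in>UNIV. E $ k $ l * \<rho> $ (i, l) $ (j, k))"
proof -
  have "cond_op \<rho> E $ i $ j
      = (\<Sum>k\<in>UNIV. \<Sum>(a, l)\<in>UNIV \<times> UNIV. (if i = a then 1 else 0) * E $ k $ l * \<rho> $ (a, l) $ (j, k))"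
    by (simp add: cond_op_def ptrace_B_def matrix_matrix_mult_def tensor_def mat_def case_prod_beta)
  also have "\<dots> = (\<Sum>k\<in>UNIV. \<Sum>a\<in>UNIV. \<Sum>l\<in>UNIV. (if i = a then 1 else 0) * E $ k $ l * \<rho> $ (a, l) $ (j, k))"
    by (simp only: sum.cartesian_product)
  also have "\<dots> = (\<Sum>k\<in>UNIV. \<Sum>l\<in>UNIV. \<Sum>a\<in>UNIV. (if i = a then E $ k $ l * \<rho> $ (a, l) $ (j, k) else 0))"
    by (subst sum.swap) (intro sum.cong refl, simp)
  finally show ?thesis
    by simp
qed

lemma cond_op_sum_list: "cond_op \<rho> (sum_list M) = (\<Sum>E\<leftarrow>M. cond_op \<rho> E)"
  by (induction M) (simp_all add: vec_eq_iff cond_op_nth distrib_right sum.distrib)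

lemma cond_op_mat_1: "cond_op \<rho> (mat 1) = ptrace_B \<rho>"
  by (simp add: vec_eq_iff cond_op_nth ptrace_B_def mat_def if_distrib[of "\<lambda>x. x * _"] cong: if_cong)

lemma sum_swap3:
  "(\<Sum>i\<in>A. \<Sum>j\<in>B. \<Sum>k\<in>C. f i j k) = (\<Sum>j\<in>B. \<Sum>k\<in>C. \<Sum>i\<in>A. f i j k)"
  by (subst sum.swap) (intro sum.cong refl sum.swap)

text \<open>Contracting \<open>\<psi>\<close> with \<open>v\<close> over the first factor gives a
  vector \<open>w\<close> on the second one at which \<open>E\<close> has the same quadratic form as
  the conditional operator has at \<open>v\<close>.\<close>

lemma psd_cond_op_ketbra:
  assumes "psd E"
  shows "psd (cond_op (ketbra \<psi>) E)"
  unfolding psd_def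
proof (intro conjI allI)
  have E: "cadjoint E = E" "\<And>v. 0 \<le> Re (cinner v (E *v v))"
    using assms by (auto simp: psd_def)
  have E': "cnj (E $ k $ l) = E $ l $ k" for k l
    using E(1) by (metis (lifting) cadjoint_def vec_lambda_beta)
  have "cnj (cond_op (ketbra \<psi>) E $ j $ i) = cond_op (ketbra \<psi>) E $ i $ j" for i j
    by (simp add: cond_op_nth ketbra_def E' mult_ac) (subst sum.swap, simp)
  then show "cadjoint (cond_op (ketbra \<psi>) E) = cond_op (ketbra \<psi>) E"
    by (simp add: vec_eq_iff cadjoint_def)
  fix v
  define w where "w = (\<chi> k. \<Sum>i\<in>UNIV. cnj (v $ i) * \<psi> $ (i, k))"
  have "cinner v (cond_op (ketbra \<psi>) E *v v)
      = (\<Sum>i\<in>UNIV. \<Sum>j\<in>UNIV. \<Sum>k\<in>UNIV. \<Sum>l\<in>UNIV.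
          cnj (v $ i) * E $ k $ l * \<psi> $ (i, l) * cnj (\<psi> $ (j, k)) * v $ j)"
    by (simp add: cinner_def matrix_vector_mult_def cond_op_nth ketbra_def
        sum_distrib_left sum_distrib_right mult_ac)
  \<comment> \<open>Two cyclic shifts of the summation order bring \<open>k\<close> and
    \<open>l\<close> outermost; the sums over \<open>i\<close> and \<open>j\<close> then factor into
    entries of \<open>w\<close> and their conjugates.\<close>
  also have "\<dots> = (\<Sum>i\<in>UNIV. \<Sum>k\<in>UNIV. \<Sum>l\<in>UNIV. \<Sum>j\<in>UNIV.
          cnj (v $ i) * E $ k $ l * \<psi> $ (i, l) * cnj (\<psi> $ (j, k)) * v $ j)"
    by (intro sum.cong refl sum_swap3)
  also have "\<dots> = (\<Sum>k\<in>UNIV. \<Sum>l\<in>UNIV. \<Sum>i\<in>UNIV. \<Sum>j\<in>UNIV.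
          cnj (v $ i) * E $ k $ l * \<psi> $ (i, l) * cnj (\<psi> $ (j, k)) * v $ j)"
    by (rule sum_swap3)
  also have "\<dots> = cinner w (E *v w)"
    by (simp add: cinner_def matrix_vector_mult_def w_def sum_distrib_left sum_distrib_right mult_ac)
  finally show "0 \<le> Re (cinner v (cond_op (ketbra \<psi>) E *v v))"
    using E(2) by simp
qed

text \<open>A rank-one effect pairs the second factor of \<open>\<psi>\<close> with
  \<open>\<phi>\<close> and leaves a single, unnormalized vector on the first. This is why rank-one
  measurements produce pure states.\<close>

lemma cond_op_ketbra_ketbra:
  "cond_op (ketbra \<psi>) (ketbra \<phi>) = ketbra (\<chi> i. \<Sum>l\<in>UNIV. cnj (\<phi> $ l) * \<psi> $ (i, l))"
  by (simp add: vec_eq_iff cond_op_nth ketbra_def sum_distrib_left sum_distrib_right mult_ac)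
    (intro allI sum.swap)

text \<open>Each weight cancels the normalization of its state. What remains is the sum of the
  conditional operators, which by linearity and completeness of the POVM is the one for the
  identity.\<close>

lemma post_ensemble_average:
  assumes "povm M"
  shows "(\<Sum>(p, \<rho>)\<leftarrow>post_ensemble (ketbra \<psi>) M. p *\<^sub>R \<rho>) = ptrace_B (ketbra \<psi>)"
proof -
  have "\<forall>E\<in>set M. psd E"
    using assms by (simp add: povm_def)
  then have "(\<Sum>(p, \<rho>)\<leftarrow>post_ensemble (ketbra \<psi>) M. p *\<^sub>R \<rho>) = (\<Sum>E\<leftarrow>M. cond_op (ketbra \<psi>) E)"
  proof (induction M)
    case (Cons E M)
    \<comment> \<open>An outcome removed by the filter contributes nothing to the sum over all of
      \<open>M\<close>.\<close>
    have "outcome_prob (ketbra \<psi>) E = 0 \<Longrightarrow> cond_op (ketbra \<psi>) E = 0"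
      using Cons.prems by (intro psd_trace_0D psd_cond_op_ketbra) (auto simp: outcome_prob_def)
    with Cons show ?case
      by (simp add: post_ensemble_def)
  qed (simp add: post_ensemble_def)
  also have "\<dots> = ptrace_B (ketbra \<psi>)"
    using assms by (simp add: povm_def cond_op_mat_1 flip: cond_op_sum_list)
  finally show ?thesis .
qed

text \<open>A nonzero trace of a positive semidefinite operator is positive, so dividing by it keeps
  positivity and gives a state.\<close>

lemma post_ensemble_memberE:
  assumes "povm M" "(p, \<rho>) \<in> set (post_ensemble (ketbra \<psi>) M)"
  obtains E where "E \<in> set M" "0 < p" "p = Re (trace (cond_op (ketbra \<psi>) E))"
    "\<rho> = (1 / p) *\<^sub>R cond_op (ketbra \<psi>) E" "psd \<rho>" "Re (trace \<rho>) = 1"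
proof -
  from assms(2) obtain E where E: "E \<in> set M" "p \<noteq> 0" "p = Re (trace (cond_op (ketbra \<psi>) E))"
    "\<rho> = (1 / p) *\<^sub>R cond_op (ketbra \<psi>) E"
    by (auto simp: post_ensemble_def outcome_prob_def)
  then have psd: "psd (cond_op (ketbra \<psi>) E)"
    using assms(1) by (auto simp: povm_def intro: psd_cond_op_ketbra)
  have p: "0 < p"
    using psd_trace_nonneg[OF psd] E(2,3) by simp
  have "Re (trace \<rho>) = (1 / p) * Re (trace (cond_op (ketbra \<psi>) E))"
    by (simp only: E(4)) (simp add: trace_def sum_divide_distrib)
  with p have "Re (trace \<rho>) = 1"
    by (simp flip: E(3))
  moreover have "psd \<rho>"
    using psd p by (simp add: E(4) psd_scaleR)
  ultimately show thesis
    using that E p by blast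
qed

text \<open>The state is \<open>ketbra a\<close> divided by the squared norm of \<open>a\<close>,
  which is a projection of trace one.\<close>

lemma post_ensemble_rank_one_entropy:
  assumes "povm M" "\<forall>E\<in>set M. \<exists>\<phi>. E = ketbra \<phi>"
    and "(p, \<rho>) \<in> set (post_ensemble (ketbra \<psi>) M)"
  shows "renyi_entropy \<alpha> \<rho> = 0"
proof -
  obtain E where E: "E \<in> set M" "0 < p" "p = Re (trace (cond_op (ketbra \<psi>) E))"
    "\<rho> = (1 / p) *\<^sub>R cond_op (ketbra \<psi>) E" "psd \<rho>" "Re (trace \<rho>) = 1"
    using post_ensemble_memberE[OF assms(1,3)] .
  obtain \<phi> where "E = ketbra \<phi>"
    using assms(2) E(1) by blast
  then obtain a where a: "cond_op (ketbra \<psi>) E = ketbra a"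
    by (simp add: cond_op_ketbra_ketbra)
  have p: "p = inner a a"
    by (simp add: E(3) a trace_ketbra Re_cinner)
  have "\<rho> ** \<rho> = (1 / p) *\<^sub>R (1 / p) *\<^sub>R (ketbra a ** ketbra a)"
    by (simp add: E(4) a vec_eq_iff matrix_matrix_mult_def scaleR_sum_right sum_divide_distrib)
  also have "\<dots> = \<rho>"
    using E(2) by (simp add: ketbra_mult_ketbra E(4) a flip: p)
  finally show ?thesis
    using renyi_entropy_pure E(5,6) by blast
qed

text \<open>The measurement in the standard basis serves; a distinct enumeration \<open>xs\<close>
  makes each basis vector occur exactly once.\<close>

lemma rank_one_povm_exists:
  obtains M :: "(complex^'n^'n) list" where "povm M" "\<forall>E\<in>set M. \<exists>\<phi>. E = ketbra \<phi>"
proof -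
  obtain xs :: "'n list" where xs: "set xs = UNIV" "distinct xs"
    using finite_distinct_list[OF finite] by blast
  define M :: "(complex^'n^'n) list" where "M = map (\<lambda>k. ketbra (axis k 1)) xs"
  have "sum_list M = (\<Sum>k\<in>UNIV. ketbra (axis k 1))"
    using xs by (simp add: M_def sum_list_distinct_conv_sum_set)
  also have "\<dots> = mat 1"
  proof -
    have "(if i = k then 1 else 0) * cnj (if j = k then 1 else 0)
        = (if k = i then if i = j then 1 else 0 else (0 :: complex))" for i j k :: 'n
      by auto
    then show ?thesis
      by (simp add: vec_eq_iff ketbra_def axis_def mat_def)
  qed
  finally have "povm M"
    by (auto simp: povm_def M_def psd_ketbra)
  then show thesis
    by (intro that[of M]) (auto simp: M_def)
qed

theorem theorem18:
  fixes \<alpha> :: real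
    and \<psi> :: "complex^('a::finite \<times> 'b::finite)"
    and \<rho>AB :: "complex^('a \<times> 'b)^('a \<times> 'b)"
    and \<rho>A :: "complex^'a^'a"
  assumes "0 < \<alpha>" and "\<alpha> < 1"
    and "norm \<psi> = 1"
    and "\<rho>AB = ketbra \<psi>"
    and "\<rho>A = ptrace_B \<rho>AB"
  shows "C_div \<alpha> \<rho>AB = ereal (renyi_entropy \<alpha> \<rho>A)"
proof (rule antisym)
  have qjsd: "qjsd \<alpha> (post_ensemble \<rho>AB M)
      = renyi_entropy \<alpha> \<rho>A - (\<Sum>(p, \<rho>)\<leftarrow>post_ensemble \<rho>AB M. p * renyi_entropy \<alpha> \<rho>)"
    if "povm M" for M
    using post_ensemble_average[OF that, of \<psi>] by (simp add: qjsd_def assms(4,5))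
  show "C_div \<alpha> \<rho>AB \<le> ereal (renyi_entropy \<alpha> \<rho>A)"
    unfolding C_div_def
  proof (rule SUP_least)
    fix M :: "(complex^'b^'b) list"
    assume "M \<in> {M. povm M}"
    then have M: "povm M"
      by simp
    \<comment> \<open>The members are states with positive weights, so the subtracted average is
      nonnegative term by term.\<close>
    have "0 \<le> p * renyi_entropy \<alpha> \<rho>" if "(p, \<rho>) \<in> set (post_ensemble \<rho>AB M)" for p \<rho>
    proof -
      have "0 < p" "psd \<rho>" "Re (trace \<rho>) = 1"
        using post_ensemble_memberE[OF M that[unfolded assms(4)]] by auto
      then show ?thesis
        by (simp add: renyi_entropy_nonneg assms(1,2))
    qed
    then have "0 \<le> (\<Sum>(p, \<rho>)\<leftarrow>post_ensemble \<rho>AB M. p * renyi_entropy \<alpha> \<rho>)"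
      by (intro sum_list_nonneg) auto
    then show "ereal (qjsd \<alpha> (post_ensemble \<rho>AB M)) \<le> ereal (renyi_entropy \<alpha> \<rho>A)"
      by (simp add: qjsd[OF M])
  qed
  \<comment> \<open>A rank-one POVM attains the upper bound, so the supremum is a maximum.\<close>
  obtain M :: "(complex^'b^'b) list" where M: "povm M" "\<forall>E\<in>set M. \<exists>\<phi>. E = ketbra \<phi>"
    using rank_one_povm_exists .
  have "(\<Sum>(p, \<rho>)\<leftarrow>post_ensemble \<rho>AB M. p * renyi_entropy \<alpha> \<rho>)
      = (\<Sum>(p, \<rho>)\<leftarrow>post_ensemble \<rho>AB M. 0)"
    by (intro arg_cong[where f = sum_list] map_cong refl)
      (auto simp: assms(4) post_ensemble_rank_one_entropy[OF M])
  also have "\<dots> = 0"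
    by (simp add: case_prod_unfold)
  finally have "ereal (renyi_entropy \<alpha> \<rho>A) = ereal (qjsd \<alpha> (post_ensemble \<rho>AB M))"
    by (simp add: qjsd[OF M(1)])
  then show "ereal (renyi_entropy \<alpha> \<rho>A) \<le> C_div \<alpha> \<rho>AB"
    unfolding C_div_def using M(1) by (auto intro: SUP_upper)
qed

end
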